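(* Let $X$ be an infinite separable metric space which has an $F_\sigma$ subset $C$ such that: $C$ (with the subspace topology) has the Hurewicz property, and for every open set $U\subset X$ with $C\subset U$, the set $X\setminus U$ is finite dimensional. Then the following are equivalent: (1) $X$ has the property $\mathsf{S}_c(\mathcal{O},\mathcal{O})$. (2) $X$ has the property $\mathsf{S}_c(\mathcal{O}_{fin},\mathcal{O})$.
   Context: Sequences $(\cdot_n : n<\infty)$ are indexed by the natural numbers. A topological space $Y$ has the Hurewicz property if for each sequence $(\mathcal{U}_n : n<\infty)$ of open covers of $Y$ there is a sequence $(\mathcal{V}_n : n<\infty)$ such that for each $n$, $\mathcal{V}_n$ is a finite subset of $\mathcal{U}_n$, and each element of $Y$ is in all but finitely many of the sets $\bigcup\mathcal{V}_n$. A family $B$ of sets refines a family $A$ if each element of $B$ is a subset of some element of $A$ (it is not required that $\bigcup B=\bigcup A$). For an infinite set $X$ and collections $\mathcal{A},\mathcal{B}$ of families of subsets of $X$, the selection principle $\mathsf{S}_c(\mathcal{A},\mathcal{B})$ states: for each sequence $(A_n : n<\infty)$ of elements of $\mathcal{A}$ there is a sequence $(B_n : n<\infty)$ such that for each $n$, $B_n$ is a pairwise disjoint family refining $A_n$, and $\bigcup_{n<\infty}B_n$ is a member of $\mathcal{B}$. For a topological space $X$, $\mathcal{O}$ denotes the collection of all open covers of $X$, and $\mathcal{O}_{fin}$ denotes the collection of all finite open covers of $X$. An $F_\sigma$ subset is a countable union of closed subsets. Finite dimensional means of finite covering dimension (as a subspace). *)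

theory Defs
  imports "HOL-Analysis.Analysis"
begin

definition open_covers :: "'a topology \<Rightarrow> 'a set set set" where
  "open_covers X = {\<U>. (\<forall>U\<in>\<U>. openin X U) \<and> \<Union>\<U> = topspace X}"

definition finite_open_covers :: "'a topology \<Rightarrow> 'a set set set" where
  "finite_open_covers X = {\<U> \<in> open_covers X. finite \<U>}"

text \<open>Refinement does not require the two families to have the same union.\<close>

definition refines :: "'a set set \<Rightarrow> 'a set set \<Rightarrow> bool" where
  "refines \<B> \<A> \<longleftrightarrow> (\<forall>B\<in>\<B>. \<exists>A\<in>\<A>. B \<subseteq> A)"

text \<open>The families \<open>B n\<close> themselves are not required to cover the space or to consist of open
  sets; such requirements come only from membership of their union in the second collection.\<close>

definition S_c :: "'a set set set \<Rightarrow> 'a set set set \<Rightarrow> bool" where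
  "S_c \<AA> \<BB> \<longleftrightarrow>
     (\<forall>A :: nat \<Rightarrow> 'a set set. (\<forall>n. A n \<in> \<AA>) \<longrightarrow>
        (\<exists>B :: nat \<Rightarrow> 'a set set.
           (\<forall>n. pairwise disjnt (B n) \<and> refines (B n) (A n)) \<and> (\<Union>n. B n) \<in> \<BB>))"

definition Hurewicz_space :: "'a topology \<Rightarrow> bool" where
  "Hurewicz_space Y \<longleftrightarrow>
     (\<forall>\<U> :: nat \<Rightarrow> 'a set set. (\<forall>n. \<U> n \<in> open_covers Y) \<longrightarrow>
        (\<exists>\<V> :: nat \<Rightarrow> 'a set set.
           (\<forall>n. finite (\<V> n) \<and> \<V> n \<subseteq> \<U> n) \<and>
           (\<forall>y\<in>topspace Y. finite {n. y \<notin> \<Union>(\<V> n)})))"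

text \<open>Covering (Cech-Lebesgue) dimension at most \<open>n\<close>: every finite open cover has a finite open
  refinement of order at most \<open>n\<close>, that is, no point lies in more than \<open>n + 1\<close> of its members.
  The library's \<^const>\<open>dimension_le\<close> is the small inductive dimension instead. The value \<open>-1\<close>
  for the empty space is not singled out, as only finiteness of the dimension is of interest.\<close>

definition covering_dim_le :: "'a topology \<Rightarrow> nat \<Rightarrow> bool" where
  "covering_dim_le X n \<longleftrightarrow>
     (\<forall>\<U>\<in>finite_open_covers X. \<exists>\<V>\<in>finite_open_covers X.
        refines \<V> \<U> \<and> (\<forall>x\<in>topspace X. card {V \<in> \<V>. x \<in> V} \<le> n + 1))"

definition finite_dimensional :: "'a topology \<Rightarrow> bool" where
  "finite_dimensional X \<longleftrightarrow> (\<exists>n. covering_dim_le X n)"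

end

theory Submission
  imports Defs
begin

text \<open>
  One direction holds because finite open covers are open covers. For the other, let a sequence
  of arbitrary open covers \<open>A n\<close> be given and split it into two infinite subsequences. The first
  is used to cover \<open>C\<close> by pairwise disjoint open refinements, the second to cover the rest.

  On \<open>C\<close> the Hurewicz property trades infinite covers for finite ones. Applied to open sets whose
  closures refine \<open>A n\<close>, it yields closed sets \<open>F n\<close>, each covered by a finite part of \<open>A n\<close>, such
  that every point of \<open>C\<close> lies in almost all \<open>F n\<close>. So \<open>C\<close> lies in the union of the closed sets
  \<open>D m = (\<Inter>n\<ge>m. F n)\<close>, and for every \<open>n \<ge> m\<close> the finite part of \<open>A n\<close> becomes a finite open cover of
  \<open>X\<close> as soon as the complement of \<open>D m\<close> is added. The selection principle for finite covers,
  applied separately for each \<open>m\<close> to infinitely many \<open>n \<ge> m\<close>, gives disjoint open families whose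
  members meeting \<open>D m\<close> refine \<open>A n\<close> and cover \<open>D m\<close>
  (\<open>Hurewicz_space_imp_selectively_screenable_in\<close>).

  The union \<open>U\<close> of the sets chosen so far is open and contains \<open>C\<close>, so its complement \<open>Z\<close> has some
  finite covering dimension \<open>n\<close>. It remains to see that \<open>2(n+1)\<close> disjoint open families suffice to
  refine any open cover on \<open>Z\<close> (\<open>covering_dim_le_screen\<close>). As the dimension is defined by finite
  covers, \<open>Z\<close> is cut into countably many closed shells, each of them covered by finitely many
  members of a countable subcover. A finite cover of a shell has a refinement of
  order at most \<open>n+1\<close>, which comparing the distances to the complements of its members (as in a
  barycentric subdivision) turns into \<open>n+1\<close> disjoint families. Shells of even index have disjoint
  neighbourhoods, and so have shells of odd index, so the families of all the shells merge into
  \<open>2(n+1)\<close> disjoint families.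
\<close>

section \<open>Open sets in metrizable spaces\<close>

lemma separable_metrizable_imp_second_countable:
  assumes "metrizable_space X" and "separable_space X"
  shows "second_countable X"
proof -
  obtain M d where "Metric_space M d" and X: "X = Metric_space.mtopology M d"
    using assms(1) by (auto simp: metrizable_space_def)
  interpret Metric_space M d by fact
  obtain C where C: "countable C" "C \<subseteq> M" "mtopology closure_of C = M"
    using assms(2) by (auto simp: separable_space_def X)
  define \<B> where "\<B> = (\<lambda>(c, n). mball c (inverse (real (Suc n)))) ` (C \<times> UNIV)"
  show ?thesis
    unfolding second_countable_def
  proof (intro exI[of _ \<B>] conjI allI impI ballI)
    show "countable \<B>"
      using C(1) by (auto simp: \<B>_def)
    show "openin X V" if "V \<in> \<B>" for V
      using that by (auto simp: \<B>_def X)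
    fix U x
    assume U: "openin X U \<and> x \<in> U"
    then have "x \<in> M"
      unfolding X openin_mtopology by blast
    obtain r where r: "r > 0" "mball x r \<subseteq> U"
      using U unfolding X openin_mtopology by blast
    obtain n where n: "inverse (real (Suc n)) < r / 2"
      using reals_Archimedean[of "r / 2"] r(1) by auto
    have "x \<in> mball x (inverse (real (Suc n)))"
      using \<open>x \<in> M\<close> by simp
    moreover have "x \<in> mtopology closure_of C"
      using \<open>x \<in> M\<close> C(3) by simp
    ultimately obtain c where c: "c \<in> C" "c \<in> mball x (inverse (real (Suc n)))"
      unfolding in_closure_of using openin_mball by blast
    have "mball c (inverse (real (Suc n))) \<subseteq> mball x r"
      using c(2) n by (intro mball_subset) (auto simp: commute)
    moreover have "x \<in> mball c (inverse (real (Suc n)))"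
      using c(2) by (simp add: commute)
    ultimately show "\<exists>V\<in>\<B>. x \<in> V \<and> V \<subseteq> U"
      using c(1) r(2) unfolding \<B>_def by (intro bexI[of _ "mball c (inverse (real (Suc n)))"]) auto
  qed
qed

text \<open>The value at \<open>x\<close> is a pointwise Lebesgue number of the family: the supremum of the radii \<open>r\<close> for
  which the ball around \<open>x\<close> lies in some \<open>U i\<close> with \<open>r \<le> (1/2) ^ i\<close>. Shrinking the ball when
  its centre moves shows that it is 1-Lipschitz. The cap \<open>(1/2) ^ i\<close> makes a large value come from a
  set of small index, so the region where the function is bounded away from \<open>0\<close> is covered by
  finitely many of the sets.\<close>

lemma metrizable_Lebesgue_function:
  fixes U :: "nat \<Rightarrow> 'a set"
  assumes "metrizable_space X" and U: "\<And>i. openin X (U i)"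
  shows "\<exists>h. continuous_map X euclideanreal h \<and> (\<forall>x. h x \<le> 1) \<and>
    (\<forall>i. \<forall>x\<in>U i. 0 < h x) \<and>
    (\<forall>k. \<forall>x\<in>topspace X. (1/2) ^ k < h x \<longrightarrow> (\<exists>i<k. x \<in> U i))"
proof -
  obtain M d where "Metric_space M d" and X: "X = Metric_space.mtopology M d"
    using assms(1) by (auto simp: metrizable_space_def)
  interpret Metric_space M d by fact
  \<comment> \<open>The radius \<open>0\<close> is admitted unconditionally, to give the value \<open>0\<close> outside all \<open>U i\<close>.\<close>
  define A where
    "A x = {r::real. 0 \<le> r \<and> r \<le> 1 \<and> (0 < r \<longrightarrow> (\<exists>i. r \<le> (1/2) ^ i \<and> mball x r \<subseteq> U i))}" for x
  define h where "h x = Sup (A x)" for x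
  have zero_A: "0 \<in> A x" for x
    by (simp add: A_def)
  have bdd: "bdd_above (A x)" for x
    by (rule bdd_aboveI[of _ 1]) (simp add: A_def)
  have upper: "r \<le> h x" if "r \<in> A x" for r x
    unfolding h_def using bdd that by (rule cSup_upper[rotated])
  have h0: "0 \<le> h x" for x
    using upper zero_A by blast
  have h1: "h x \<le> 1" for x
    unfolding h_def
  proof (rule cSup_least)
    show "A x \<noteq> {}" using zero_A by blast
  qed (simp add: A_def)
  have lip: "h x \<le> h y + d x y" if "x \<in> M" "y \<in> M" for x y
  proof -
    have "r \<le> h y + d x y" if r: "r \<in> A x" for r
    proof (cases "r \<le> d x y")
      case True
      then show ?thesis using h0[of y] by linarith
    next
      case False
      then have "0 < r" using nonneg[of x y] by linarith
      then obtain i where i: "r \<le> (1/2) ^ i" "mball x r \<subseteq> U i"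
        using r by (auto simp: A_def)
      have "mball y (r - d x y) \<subseteq> mball x r"
        using \<open>x \<in> M\<close> by (intro mball_subset) (auto simp: commute)
      then have "r - d x y \<in> A y"
        using r i False nonneg[of x y] unfolding A_def
        by (auto intro!: exI[of _ i] simp del: nonneg)
      then show ?thesis using upper by fastforce
    qed
    then show ?thesis
      unfolding h_def[of x] using zero_A[of x] by (intro cSup_least) blast+
  qed
  have "continuous_map X euclideanreal h"
    unfolding continuous_map_upper_lower_semicontinuous_lt
  proof (intro conjI allI)
    fix a
    show "openin X {x \<in> topspace X. h x > a}"
      unfolding X openin_mtopology topspace_mtopology
    proof (intro conjI allI impI)
      fix x assume x: "x \<in> {x \<in> M. h x > a}"
      have "h y > a" if "y \<in> mball x (h x - a)" for y
        using lip[of x y] that by auto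
      then show "\<exists>r>0. mball x r \<subseteq> {x \<in> M. h x > a}"
        using x by (intro exI[of _ "h x - a"]) auto
    qed auto
    show "openin X {x \<in> topspace X. h x < a}"
      unfolding X openin_mtopology topspace_mtopology
    proof (intro conjI allI impI)
      fix x assume x: "x \<in> {x \<in> M. h x < a}"
      have "h y < a" if "y \<in> mball x (a - h x)" for y
        using lip[of y x] that by (auto simp: commute)
      then show "\<exists>r>0. mball x r \<subseteq> {x \<in> M. h x < a}"
        using x by (intro exI[of _ "a - h x"]) auto
    qed auto
  qed
  moreover have "0 < h x" if xU: "x \<in> U i" for i x
  proof -
    obtain r where r: "r > 0" "mball x r \<subseteq> U i"
      using U[of i] xU unfolding X openin_mtopology by blast
    define s where "s = min r ((1/2) ^ i)"
    have "s \<le> (1/2) ^ i" by (simp add: s_def)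
    also have "\<dots> \<le> 1" by (simp add: power_le_one)
    finally have "s \<in> A x"
      using r mball_subset_concentric[of s r x] unfolding A_def s_def
      by (auto intro!: exI[of _ i] simp del: power_one_over)
    moreover have "0 < s" using r by (simp add: s_def)
    ultimately show ?thesis using upper by fastforce
  qed
  moreover have "\<exists>i<k. x \<in> U i" if xX: "x \<in> topspace X" and xk: "(1/2) ^ k < h x" for k x
  proof -
    obtain r where r: "r \<in> A x" "(1/2) ^ k < r"
      using xk less_cSup_iff[OF _ bdd[of x]] zero_A[of x] unfolding h_def by blast
    have "0 < r" using r(2) by (meson half_gt_zero_iff less_trans zero_less_one zero_less_power)
    then obtain i where i: "r \<le> (1/2) ^ i" "mball x r \<subseteq> U i"
      using r by (auto simp: A_def)
    have "((1/2) ^ k::real) < (1/2) ^ i" using r i by linarith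
    then have "i < k" by (simp add: power_strict_decreasing_iff)
    moreover have "x \<in> U i" using i(2) \<open>0 < r\<close> xX by (auto simp: X)
    ultimately show ?thesis by blast
  qed
  ultimately show ?thesis
    using h1 by (intro exI[of _ h]) blast
qed

lemma metrizable_open_imp_positivity_set:
  assumes "metrizable_space X" and V: "openin X V"
  shows "\<exists>f. continuous_map X euclideanreal f \<and> (\<forall>x\<in>topspace X. 0 < f x \<longleftrightarrow> x \<in> V)"
proof -
  obtain h where h: "continuous_map X euclideanreal h \<and> (\<forall>x. h x \<le> 1) \<and>
      (\<forall>i::nat. \<forall>x\<in>V. 0 < h x) \<and>
      (\<forall>k. \<forall>x\<in>topspace X. (1/2) ^ k < h x \<longrightarrow> (\<exists>i::nat<k. x \<in> V))"
    using metrizable_Lebesgue_function[OF assms(1), of "\<lambda>_. V", OF V] by (rule exE)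
  have "x \<in> V" if x: "x \<in> topspace X" and "0 < h x" for x
  proof -
    obtain k where "(1/2) ^ k < h x"
      using real_arch_pow_inv[OF \<open>0 < h x\<close>, of "1/2"] by auto
    then show ?thesis using h x by blast
  qed
  then have "\<forall>x\<in>topspace X. 0 < h x \<longleftrightarrow> x \<in> V"
    using h by blast
  with h show ?thesis by blast
qed

text \<open>Around each point of \<open>V\<close> take balls whose radius is half of what still fits into \<open>V\<close> relative to
  \<open>Z\<close>. If such balls around \<open>v \<in> V\<close> and \<open>w \<in> W\<close> met, then \<open>v\<close> and \<open>w\<close> would be closer than twice the
  larger radius, and one of them would lie in both sets.\<close>

lemma metrizable_disjoint_extension:
  assumes "metrizable_space X" and "Z \<subseteq> topspace X"
  shows "\<exists>E. (\<forall>V. openin X (E V)) \<and> (\<forall>V. openin (subtopology X Z) V \<longrightarrow> V \<subseteq> E V) \<and>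
    (\<forall>V W. disjnt V W \<longrightarrow> disjnt (E V) (E W))"
proof -
  obtain M d where "Metric_space M d" and X: "X = Metric_space.mtopology M d"
    using assms(1) by (auto simp: metrizable_space_def)
  interpret Metric_space M d by fact
  define E where "E V = \<Union>{mball v r |v r. v \<in> V \<inter> Z \<and> mball v (2 * r) \<inter> Z \<subseteq> V}" for V
  have "openin X (E V)" for V
    unfolding E_def X by (rule openin_Union) auto
  moreover have "V \<subseteq> E V" if V: "openin (subtopology X Z) V" for V
  proof
    fix x assume "x \<in> V"
    obtain T where T: "openin X T" "V = T \<inter> Z"
      using V by (auto simp: openin_subtopology)
    then obtain r where r: "r > 0" "mball x r \<subseteq> T"
      using \<open>x \<in> V\<close> unfolding X openin_mtopology by blast
    have "x \<in> M" using \<open>x \<in> V\<close> T assms(2) by (auto simp: X)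
    have "mball x (2 * (r / 2)) \<inter> Z \<subseteq> V" using r T by auto
    moreover have "x \<in> mball x (r / 2)" using r \<open>x \<in> M\<close> by simp
    ultimately show "x \<in> E V"
      unfolding E_def using \<open>x \<in> V\<close> T by blast
  qed
  moreover have "disjnt (E V) (E W)" if "disjnt V W" for V W
  proof -
    have False if "x \<in> E V" "x \<in> E W" for x
    proof -
      obtain v r where v: "v \<in> V" "v \<in> Z" "mball v (2 * r) \<inter> Z \<subseteq> V" "x \<in> mball v r"
        using \<open>x \<in> E V\<close> by (auto simp: E_def)
      obtain w s where w: "w \<in> W" "w \<in> Z" "mball w (2 * s) \<inter> Z \<subseteq> W" "x \<in> mball w s"
        using \<open>x \<in> E W\<close> by (auto simp: E_def)
      have "d v w < r + s"
        using v(4) w(4) triangle'[of v x w] by auto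
      then have "w \<in> mball v (2 * r) \<or> v \<in> mball w (2 * s)"
        using v(4) w(4) commute[of v w] by auto
      then show False
        using v w \<open>disjnt V W\<close> by (auto simp: disjnt_iff)
    qed
    then show ?thesis by (auto simp: disjnt_iff)
  qed
  ultimately show ?thesis by (intro exI[of _ E]) blast
qed

section \<open>Disjoint families from covering dimension\<close>

definition disjoint_open_refinement :: "'a topology \<Rightarrow> 'a set set \<Rightarrow> 'a set set \<Rightarrow> bool" where
  "disjoint_open_refinement X \<B> \<A> \<longleftrightarrow>
     pairwise disjnt \<B> \<and> refines \<B> \<A> \<and> (\<forall>V\<in>\<B>. openin X V)"

text \<open>With \<open>f V\<close> positive exactly on \<open>V\<close>, let \<open>W S\<close> consist of the points where the functions indexed
  by \<open>S\<close> are positive and strictly exceed all the others; in the nerve of \<open>\<V>\<close> this is the open star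
  of the barycentre of \<open>S\<close>. Two different sets of indices of the same size each contain an index
  missing from the other, and a common point would order these two function values both
  ways.\<close>

lemma metrizable_barycentric_decomposition:
  assumes "metrizable_space X" and fin: "finite \<V>" and op: "\<forall>V\<in>\<V>. openin X V"
  shows "\<exists>W. (\<forall>S\<subseteq>\<V>. openin X (W S)) \<and> (\<forall>S\<subseteq>\<V>. \<forall>V\<in>S. W S \<subseteq> V) \<and>
    (\<forall>S\<subseteq>\<V>. \<forall>T\<subseteq>\<V>. card S = card T \<longrightarrow> S \<noteq> T \<longrightarrow> disjnt (W S) (W T)) \<and>
    (\<forall>x\<in>topspace X. x \<in> W {V \<in> \<V>. x \<in> V})"
proof -
  have "\<forall>V\<in>\<V>. \<exists>f. continuous_map X euclideanreal f \<and>
      (\<forall>x\<in>topspace X. 0 < f x \<longleftrightarrow> x \<in> V)"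
    using metrizable_open_imp_positivity_set[OF assms(1) op[rule_format]] by blast
  from bchoice[OF this] obtain f where f: "\<And>V. V \<in> \<V> \<Longrightarrow> continuous_map X euclideanreal (f V)"
    "\<And>V x. V \<in> \<V> \<Longrightarrow> x \<in> topspace X \<Longrightarrow> 0 < f V x \<longleftrightarrow> x \<in> V"
    by blast
  \<comment> \<open>Intersecting with the whole space gives the right value to an intersection over no indices.\<close>
  define W where "W S = (\<Inter>V\<in>S. {x \<in> topspace X. 0 < f V x}) \<inter> topspace X \<inter>
    ((\<Inter>(V, V')\<in>S \<times> (\<V> - S). {x \<in> topspace X. f V' x < f V x}) \<inter> topspace X)" for S
  show ?thesis
  proof (intro exI[of _ W] conjI allI impI ballI)
    show "openin X (W S)" if S: "S \<subseteq> \<V>" for S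
    proof -
      have "openin X {x \<in> topspace X. 0 < f V x}" if "V \<in> S" for V
        using f(1)[of V] S that
        unfolding continuous_map_upper_lower_semicontinuous_lt by auto
      moreover have "openin X {x \<in> topspace X. f V' x < f V x}" if "V \<in> S" "V' \<in> \<V> - S" for V V'
      proof -
        have "continuous_map X euclideanreal (\<lambda>x. f V x - f V' x)"
          using f(1) that \<open>S \<subseteq> \<V>\<close> by (intro continuous_map_diff) auto
        then have "openin X {x \<in> topspace X. 0 < f V x - f V' x}"
          unfolding continuous_map_upper_lower_semicontinuous_lt by blast
        then show ?thesis by simp
      qed
      moreover have fS: "finite S" "finite (S \<times> (\<V> - S))"
        using fin finite_subset[OF S] by auto
      ultimately show ?thesis
        unfolding W_def by (intro openin_Int[OF openin_INT[OF fS(1)] openin_INT[OF fS(2)]]) auto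
    qed
    show "W S \<subseteq> V" if "S \<subseteq> \<V>" "V \<in> S" for S V
      using f(2) that by (auto simp: W_def)
    show "disjnt (W S) (W T)"
      if ST: "S \<subseteq> \<V>" "T \<subseteq> \<V>" "card S = card T" "S \<noteq> T" for S T
    proof -
      have "finite S" "finite T" using ST fin finite_subset by auto
      then have "\<not> S \<subseteq> T" "\<not> T \<subseteq> S"
        using ST card_subset_eq by metis+
      then obtain V V' where "V \<in> S - T" "V' \<in> T - S" by blast
      then have "f V' x < f V x" if "x \<in> W S" for x
        using that ST by (auto simp: W_def)
      moreover have "f V x < f V' x" if "x \<in> W T" for x
        using that ST \<open>V \<in> S - T\<close> \<open>V' \<in> T - S\<close> by (auto simp: W_def)
      ultimately show ?thesis
        unfolding disjnt_iff by (meson less_asym)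
    qed
    show "x \<in> W {V \<in> \<V>. x \<in> V}" if "x \<in> topspace X" for x
    proof -
      have "f V' x < f V x" if "V \<in> \<V>" "x \<in> V" "V' \<in> \<V>" "x \<notin> V'" for V V'
      proof -
        have "f V' x \<le> 0"
          using f(2)[OF \<open>V' \<in> \<V>\<close> \<open>x \<in> topspace X\<close>] \<open>x \<notin> V'\<close> by linarith
        also have "\<dots> < f V x"
          using f(2)[OF \<open>V \<in> \<V>\<close> \<open>x \<in> topspace X\<close>] \<open>x \<in> V\<close> by blast
        finally show ?thesis .
      qed
      then show ?thesis
        using f(2) that by (auto simp: W_def)
    qed
  qed
qed

text \<open>The cover of \<open>K\<close> is completed to one of \<open>Z\<close> by the complement of \<open>K\<close>. In a refinement of order at
  most \<open>n + 1\<close> every point \<open>x\<close> lies in \<open>W S\<close>, where \<open>S\<close> is the set of the at most \<open>n + 1\<close> members that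
  contain \<open>x\<close>; grouping the sets \<open>W S\<close> by the size of \<open>S\<close> gives the disjoint families.\<close>

lemma covering_dim_le_finite_screen:
  assumes X: "metrizable_space X" and Z: "Z \<subseteq> topspace X"
    and dim: "covering_dim_le (subtopology X Z) n"
    and K: "closedin (subtopology X Z) K"
    and G: "finite \<G>" "\<And>G. G \<in> \<G> \<Longrightarrow> openin X G" "K \<subseteq> \<Union>\<G>"
  shows "\<exists>D :: nat \<Rightarrow> 'a set set. (\<forall>j. disjoint_open_refinement X (D j) \<G>) \<and>
    K \<subseteq> (\<Union>j\<le>n. \<Union>(D j))"
proof -
  let ?Z = "subtopology X Z"
  have topZ: "topspace ?Z = Z" using Z by (simp add: Int_absorb1)
  have KZ: "K \<subseteq> Z" using closedin_subset[OF K] topZ by simp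
  have "openin ?Z (Z - K)"
    using openin_diff[OF openin_topspace K] unfolding topZ .
  then have "insert (Z - K) ((\<inter>) Z ` \<G>) \<in> finite_open_covers ?Z"
    unfolding finite_open_covers_def open_covers_def
    using G KZ openin_subtopology_Int2[of X _ Z] unfolding topZ by auto
  then obtain \<V> where V: "\<V> \<in> finite_open_covers ?Z"
    "refines \<V> (insert (Z - K) ((\<inter>) Z ` \<G>))"
    "\<And>x. x \<in> Z \<Longrightarrow> card {V \<in> \<V>. x \<in> V} \<le> n + 1"
    using dim unfolding covering_dim_le_def topZ by blast
  have fV: "finite \<V>" and oV: "\<forall>V\<in>\<V>. openin ?Z V" and cV: "\<Union>\<V> = Z"
    using V(1) unfolding finite_open_covers_def open_covers_def topZ by auto
  from metrizable_barycentric_decomposition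
    [OF metrizable_space_subtopology[OF X, of Z] fV oV, unfolded topZ]
  obtain W where W': "\<forall>S\<subseteq>\<V>. openin ?Z (W S)" "\<forall>S\<subseteq>\<V>. \<forall>V\<in>S. W S \<subseteq> V"
    "\<forall>S\<subseteq>\<V>. \<forall>T\<subseteq>\<V>. card S = card T \<longrightarrow> S \<noteq> T \<longrightarrow> disjnt (W S) (W T)"
    "\<forall>x\<in>Z. x \<in> W {V \<in> \<V>. x \<in> V}"
    by (elim exE conjE)
  note W = W'[rule_format]
  from metrizable_disjoint_extension[OF X Z]
  obtain E where E': "\<forall>V. openin X (E V)" "\<forall>V. openin ?Z V \<longrightarrow> V \<subseteq> E V"
    "\<forall>V W. disjnt V W \<longrightarrow> disjnt (E V) (E W)"
    by (elim exE conjE)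
  note E = E'[rule_format]
  \<comment> \<open>Extending \<open>W S\<close> from \<open>Z\<close> to \<open>X\<close> may leave the member of \<open>\<G>\<close> that contains it, hence the
    intersection with \<open>g S\<close>. The shift in \<open>Suc j\<close> reflects that \<open>S\<close> is never empty.\<close>
  define g where "g S = (SOME G. G \<in> \<G> \<and> W S \<subseteq> G)" for S
  have g: "g S \<in> \<G>" "W S \<subseteq> g S" if "\<exists>G\<in>\<G>. W S \<subseteq> G" for S
    using someI_ex[of "\<lambda>G. G \<in> \<G> \<and> W S \<subseteq> G"] that unfolding g_def by blast+
  define D where
    "D j = (\<lambda>S. E (W S) \<inter> g S) ` {S. S \<subseteq> \<V> \<and> card S = Suc j \<and> (\<exists>G\<in>\<G>. W S \<subseteq> G)}" for j
  show ?thesis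
  proof (intro exI[of _ D] conjI allI)
    fix j
    show "disjoint_open_refinement X (D j) \<G>"
      unfolding disjoint_open_refinement_def
    proof (intro conjI ballI)
      show "pairwise disjnt (D j)"
        unfolding pairwise_def
      proof (intro ballI impI)
        fix P Q assume P: "P \<in> D j" and Q: "Q \<in> D j" and "P \<noteq> Q"
        obtain S where S: "S \<subseteq> \<V>" "card S = Suc j" "P = E (W S) \<inter> g S"
          using P unfolding D_def by blast
        obtain T where T: "T \<subseteq> \<V>" "card T = Suc j" "Q = E (W T) \<inter> g T"
          using Q unfolding D_def by blast
        have "S \<noteq> T" using \<open>P \<noteq> Q\<close> S(3) T(3) by blast
        then have "disjnt (E (W S)) (E (W T))" using W(3) E(3) S(1,2) T(1,2) by metis
        then show "disjnt P Q" unfolding S(3) T(3) by (auto simp: disjnt_iff)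
      qed
      show "refines (D j) \<G>"
        using g unfolding refines_def D_def by blast
      show "openin X V" if "V \<in> D j" for V
        using that g(1) E(1) G(2) unfolding D_def by auto
    qed
  next
    show "K \<subseteq> (\<Union>j\<le>n. \<Union>(D j))"
    proof
      fix x assume "x \<in> K"
      then have "x \<in> Z" using KZ by blast
      define S where "S = {V \<in> \<V>. x \<in> V}"
      have S: "S \<subseteq> \<V>" "x \<in> W S" using W(4) \<open>x \<in> Z\<close> by (auto simp: S_def)
      obtain V where "V \<in> S" using \<open>x \<in> Z\<close> cV by (auto simp: S_def)
      have "\<exists>P\<in>insert (Z - K) ((\<inter>) Z ` \<G>). V \<subseteq> P"
        using V(2) \<open>V \<in> S\<close> S(1) unfolding refines_def by blast
      moreover have "\<not> V \<subseteq> Z - K" using \<open>V \<in> S\<close> \<open>x \<in> K\<close> by (auto simp: S_def)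
      ultimately have GS: "\<exists>G\<in>\<G>. W S \<subseteq> G" using W(2)[OF S(1) \<open>V \<in> S\<close>] by blast
      have "finite S" using S(1) fV finite_subset by blast
      then have "card S \<noteq> 0" using \<open>V \<in> S\<close> by auto
      then obtain j where j: "card S = Suc j" using not0_implies_Suc by blast
      then have "j \<le> n" using V(3)[OF \<open>x \<in> Z\<close>] by (simp add: S_def)
      moreover have "x \<in> E (W S) \<inter> g S"
        using S g(2)[OF GS] E(2)[OF W(1)[OF S(1)]] by blast
      moreover have "E (W S) \<inter> g S \<in> D j"
        using S(1) j GS unfolding D_def by blast
      ultimately show "x \<in> (\<Union>j\<le>n. \<Union>(D j))" by blast
    qed
  qed
qed

lemma dyadic_shell:
  fixes t :: real
  assumes "0 < t" and "t \<le> 1"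
  obtains k :: nat where "(1/2) ^ Suc k < t" and "t \<le> (1/2) ^ k"
proof -
  have ex: "\<exists>k. (1/2) ^ k < t"
    using real_arch_pow_inv[OF assms(1), of "1/2"] by auto
  define m where "m = (LEAST k. (1/2) ^ k < t)"
  have m: "(1/2) ^ m < t" unfolding m_def using ex by (rule LeastI_ex)
  then have "m \<noteq> 0" using assms(2) by (cases m) auto
  then obtain k where k: "m = Suc k" using not0_implies_Suc by blast
  then have "\<not> (1/2) ^ k < t"
    using not_less_Least[of k "\<lambda>k. (1/2) ^ k < t"] unfolding m_def[symmetric] by simp
  then show ?thesis using that[of k] m unfolding k by simp
qed

text \<open>The level sets \<open>(1/2) ^ (k + 1) \<le> h \<le> (1/2) ^ k\<close> of a Lebesgue function \<open>h\<close> of a countable subcover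
  are closed shells, each covered by finitely many members, so the finite case applies to each.
  Cutting the resulting sets down to slightly larger open shells \<open>N k\<close> makes those of shells two or
  more steps apart disjoint, so one family can serve all the even shells and another one all the
  odd shells.\<close>

lemma covering_dim_le_screen:
  assumes X: "metrizable_space X" "second_countable X" and Z: "Z \<subseteq> topspace X"
    and dim: "covering_dim_le (subtopology X Z) n"
    and op: "\<And>V. V \<in> \<O> \<Longrightarrow> openin X V" and cov: "Z \<subseteq> \<Union>\<O>"
  shows "\<exists>E :: nat \<Rightarrow> 'a set set. (\<forall>i. disjoint_open_refinement X (E i) \<O>) \<and>
    Z \<subseteq> (\<Union>i<2*(n+1). \<Union>(E i))"
proof (cases "Z = {}")
  case True
  then show ?thesis
    by (intro exI[of _ "\<lambda>_. {}"]) (simp add: disjoint_open_refinement_def refines_def)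
next
  case False
  have "Lindelof_space (subtopology X Z)"
    using second_countable_subtopology[OF X(2)] by (rule second_countable_imp_Lindelof_space)
  then obtain \<P> where P: "countable \<P>" "\<P> \<subseteq> \<O>" "Z \<subseteq> \<Union>\<P>"
    using op cov unfolding Lindelof_space_subtopology_subset[OF Z] by meson
  then have "\<P> \<noteq> {}" using False by auto
  define U where "U = from_nat_into \<P>"
  have rU: "range U = \<P>"
    unfolding U_def using \<open>\<P> \<noteq> {}\<close> P(1) by (rule range_from_nat_into)
  have U_in: "U i \<in> \<O>" for i
    using rU P(2) by blast
  have oU: "openin X (U i)" for i
    using U_in op by blast
  from metrizable_Lebesgue_function[of X U, OF X(1) oU]
  obtain h where h': "continuous_map X euclideanreal h" "\<forall>x. h x \<le> 1"
    "\<forall>i. \<forall>x\<in>U i. 0 < h x"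
    "\<forall>k. \<forall>x\<in>topspace X. (1/2) ^ k < h x \<longrightarrow> (\<exists>i<k. x \<in> U i)"
    by (elim exE conjE)
  note h = h'[rule_format]
  \<comment> \<open>The factors \<open>2/3\<close> and \<open>4/3\<close> are chosen so that the open shells \<open>N k\<close> and \<open>N (k + 2)\<close> just fail
    to meet: both are bounded by the value \<open>(1/2) ^ k / 3\<close>.\<close>
  define K where "K k = {x \<in> topspace (subtopology X Z). h x \<in> {(1/2) ^ Suc k .. (1/2) ^ k}}" for k
  define N where "N k = {x \<in> topspace X. h x \<in> {2/3 * (1/2) ^ Suc k <..< 4/3 * (1/2) ^ k}}" for k
  have K: "closedin (subtopology X Z) (K k)" for k
    unfolding K_def by (rule closedin_continuous_map_preimage[where Y=euclideanreal])
      (use h(1) in \<open>auto simp: continuous_map_from_subtopology\<close>)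
  have N: "openin X (N k)" for k
    unfolding N_def by (rule openin_continuous_map_preimage[OF h(1)]) simp
  have N_disj: "disjnt (N k) (N l)" if "k + 2 \<le> l" for k l
  proof -
    have "((1/2) ^ l :: real) \<le> (1/2) ^ (k + 2)"
      using that by (intro power_decreasing) auto
    then have "4/3 * (1/2) ^ l \<le> (2/3 * (1/2) ^ Suc k :: real)"
      by (simp add: power_add)
    then show ?thesis by (auto simp: N_def disjnt_iff)
  qed
  have K_cov: "K k \<subseteq> \<Union>(U ` {..<k+2})" for k
  proof
    fix x assume x: "x \<in> K k"
    have "((1/2) ^ (k+2) :: real) < (1/2) ^ Suc k"
      by (intro power_strict_decreasing) auto
    also have "\<dots> \<le> h x" using x by (simp add: K_def)
    finally show "x \<in> \<Union>(U ` {..<k+2})"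
      using h(4)[of x "k+2"] x by (auto simp: K_def)
  qed
  have "\<exists>D :: nat \<Rightarrow> 'a set set. (\<forall>j. disjoint_open_refinement X (D j) (U ` {..<k+2})) \<and>
      K k \<subseteq> (\<Union>j\<le>n. \<Union>(D j))" for k
    by (rule covering_dim_le_finite_screen[OF X(1) Z dim K[of k] _ _ K_cov[of k]])
      (use oU in auto)
  then obtain D :: "nat \<Rightarrow> nat \<Rightarrow> 'a set set" where
    D': "\<And>k j. disjoint_open_refinement X (D k j) (U ` {..<k+2})" and
    D_cov: "\<And>k. K k \<subseteq> (\<Union>j\<le>n. \<Union>(D k j))"
    by metis
  note D = D'[unfolded disjoint_open_refinement_def]
  \<comment> \<open>The index \<open>i = 2 * j + p\<close> encodes the \<open>j\<close>-th family on the shells of parity \<open>p\<close>.\<close>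
  define E where "E i = {N k \<inter> V |k V. k mod 2 = i mod 2 \<and> V \<in> D k (i div 2)}" for i
  show ?thesis
  proof (intro exI[of _ E] conjI allI)
    fix i
    show "disjoint_open_refinement X (E i) \<O>"
      unfolding disjoint_open_refinement_def
    proof (intro conjI ballI)
      show "pairwise disjnt (E i)"
        unfolding pairwise_def
      proof (intro ballI impI)
        fix P Q assume P: "P \<in> E i" and Q: "Q \<in> E i" and "P \<noteq> Q"
        obtain k V where k: "k mod 2 = i mod 2" "V \<in> D k (i div 2)" "P = N k \<inter> V"
          using P unfolding E_def by blast
        obtain l W where l: "l mod 2 = i mod 2" "W \<in> D l (i div 2)" "Q = N l \<inter> W"
          using Q unfolding E_def by blast
        note PQ = k(3) l(3)
        have "k mod 2 = l mod 2" using k(1) l(1) by simp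
        then have "k = l \<or> k + 2 \<le> l \<or> l + 2 \<le> k" by presburger
        then consider "k = l" | "k + 2 \<le> l" | "l + 2 \<le> k" by blast
        then show "disjnt P Q"
        proof cases
          case 1
          then have "disjnt V W"
            using D[of k "i div 2"] k(2) l(2) PQ \<open>P \<noteq> Q\<close> unfolding pairwise_def by auto
          then show ?thesis unfolding PQ by (auto simp: disjnt_iff)
        next
          case 2
          then show ?thesis using N_disj[OF 2] unfolding PQ by (auto simp: disjnt_iff)
        next
          case 3
          then show ?thesis using N_disj[OF 3] unfolding PQ by (auto simp: disjnt_iff)
        qed
      qed
      show "refines (E i) \<O>"
        unfolding refines_def
      proof
        fix P assume "P \<in> E i"
        then obtain k V where V: "V \<in> D k (i div 2)" "P \<subseteq> V" by (auto simp: E_def)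
        have "\<exists>m. V \<subseteq> U m"
          using D[of k "i div 2"] V(1) unfolding refines_def by blast
        then show "\<exists>A\<in>\<O>. P \<subseteq> A" using V(2) U_in by (meson order_trans)
      qed
      show "openin X V" if "V \<in> E i" for V
        using that N D by (auto simp: E_def)
    qed
  next
    show "Z \<subseteq> (\<Union>i<2*(n+1). \<Union>(E i))"
    proof
      fix x assume "x \<in> Z"
      then have "0 < h x" using P(3) rU h(3) by blast
      then obtain k where k: "(1/2) ^ Suc k < h x" "h x \<le> (1/2) ^ k"
        using dyadic_shell[OF _ h(2)] by blast
      have "x \<in> K k" using k \<open>x \<in> Z\<close> Z by (auto simp: K_def)
      then obtain j V where jV: "j \<le> n" "V \<in> D k j" "x \<in> V" using D_cov by blast
      have "2/3 * (1/2) ^ Suc k < h x" "h x < 4/3 * (1/2) ^ k"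
        using k zero_less_power[of "1/2::real" k] by simp_all
      then have "x \<in> N k" using \<open>x \<in> Z\<close> Z by (auto simp: N_def)
      define i where "i = 2 * j + k mod 2"
      have "i < 2 * (n + 1)" "i mod 2 = k mod 2" "i div 2 = j"
        using jV(1) unfolding i_def by presburger+
      then have "N k \<inter> V \<in> E i" using jV(2) unfolding E_def by force
      then show "x \<in> (\<Union>i<2*(n+1). \<Union>(E i))"
        using \<open>x \<in> N k\<close> jV(3) \<open>i < 2 * (n + 1)\<close> by blast
    qed
  qed
qed

section \<open>Relative selective screenability\<close>

text \<open>The relative form of \<open>S_c (open_covers X) (open_covers X)\<close>, where only \<open>Y\<close> has to be covered. The
  families still consist of sets open in \<open>X\<close>, so that those found for several subsets can be
  combined.\<close>

definition selectively_screenable_in :: "'a topology \<Rightarrow> 'a set \<Rightarrow> bool" where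
  "selectively_screenable_in X Y \<longleftrightarrow>
     (\<forall>A :: nat \<Rightarrow> 'a set set. (\<forall>n. A n \<in> open_covers X) \<longrightarrow>
        (\<exists>B :: nat \<Rightarrow> 'a set set.
           (\<forall>n. disjoint_open_refinement X (B n) (A n)) \<and> Y \<subseteq> (\<Union>n. \<Union>(B n))))"

text \<open>Finitely many families suffice, so it is enough to screen a common refinement of the first
  \<open>2 * (n + 1)\<close> covers and to leave the later families empty.\<close>

lemma finite_dimensional_imp_selectively_screenable_in:
  assumes X: "metrizable_space X" "second_countable X" and Z: "Z \<subseteq> topspace X"
    and dim: "finite_dimensional (subtopology X Z)"
  shows "selectively_screenable_in X Z"
  unfolding selectively_screenable_in_def
proof (intro allI impI)
  fix A :: "nat \<Rightarrow> 'a set set"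
  assume A: "\<forall>n. A n \<in> open_covers X"
  obtain n where n: "covering_dim_le (subtopology X Z) n"
    using dim by (auto simp: finite_dimensional_def)
  define \<O> where "\<O> = {W. openin X W \<and> (\<forall>i<2*(n+1). \<exists>G\<in>A i. W \<subseteq> G)}"
  have "Z \<subseteq> \<Union>\<O>"
  proof
    fix x assume "x \<in> Z"
    then have "\<forall>i. \<exists>G\<in>A i. x \<in> G"
      using A Z unfolding open_covers_def by blast
    then obtain G where G: "\<And>i. G i \<in> A i" "\<And>i. x \<in> G i" by metis
    have "openin X ((\<Inter>i\<in>{..<2*(n+1)}. G i) \<inter> topspace X)"
      using G(1) A by (intro openin_INT) (auto simp: open_covers_def)
    then have "(\<Inter>i\<in>{..<2*(n+1)}. G i) \<inter> topspace X \<in> \<O>"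
      unfolding \<O>_def using G(1) by blast
    then show "x \<in> \<Union>\<O>" using G(2) \<open>x \<in> Z\<close> Z by blast
  qed
  moreover have "openin X W" if "W \<in> \<O>" for W
    using that by (simp add: \<O>_def)
  ultimately obtain E :: "nat \<Rightarrow> 'a set set" where
    E: "\<And>i. disjoint_open_refinement X (E i) \<O>" and cov: "Z \<subseteq> (\<Union>i<2*(n+1). \<Union>(E i))"
    using covering_dim_le_screen[OF X Z n, of \<O>] by metis
  define B where "B i = (if i < 2*(n+1) then E i else {})" for i
  have "refines (E i) (A i)" if i: "i < 2*(n+1)" for i
    unfolding refines_def
  proof
    fix V assume "V \<in> E i"
    then obtain W where "W \<in> \<O>" "V \<subseteq> W"
      using E unfolding disjoint_open_refinement_def refines_def by blast
    moreover obtain G where "G \<in> A i" "W \<subseteq> G" using \<open>W \<in> \<O>\<close> i unfolding \<O>_def by blast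
    ultimately show "\<exists>G\<in>A i. V \<subseteq> G" by blast
  qed
  then have "disjoint_open_refinement X (B i) (A i)" for i
    using E[of i] by (simp add: B_def disjoint_open_refinement_def refines_def)
  moreover have "Z \<subseteq> (\<Union>i. \<Union>(B i))"
  proof
    fix x assume "x \<in> Z"
    then obtain i where "i < 2*(n+1)" "x \<in> \<Union>(E i)" using cov by blast
    then have "x \<in> \<Union>(B i)" by (simp add: B_def)
    then show "x \<in> (\<Union>i. \<Union>(B i))" by blast
  qed
  ultimately show "\<exists>B. (\<forall>n. disjoint_open_refinement X (B n) (A n)) \<and> Z \<subseteq> (\<Union>n. \<Union>(B n))"
    by blast
qed

text \<open>The Hurewicz property is applied to the traces on \<open>C\<close> of those open sets whose closure in \<open>X\<close>
  fits into a member of the given cover; regularity makes them cover \<open>C\<close>. Passing to the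
  closures gives sets closed in the whole of \<open>X\<close>, whose complements can be used in open
  covers.\<close>

lemma Hurewicz_space_closed_selection:
  fixes A :: "nat \<Rightarrow> 'a set set"
  assumes X: "regular_space X" and CX: "C \<subseteq> topspace X"
    and Hur: "Hurewicz_space (subtopology X C)" and A: "\<And>n. A n \<in> open_covers X"
  obtains F \<G> where "\<And>n. closedin X (F n)" and "\<And>n. finite (\<G> n)" and "\<And>n. \<G> n \<subseteq> A n"
    and "\<And>n. F n \<subseteq> \<Union>(\<G> n)" and "\<And>x. x \<in> C \<Longrightarrow> finite {n. x \<notin> F n}"
proof -
  define \<U> where
    "\<U> n = {C \<inter> P |P. openin X P \<and> (\<exists>G\<in>A n. X closure_of P \<subseteq> G)}" for n
  have "\<U> n \<in> open_covers (subtopology X C)" for n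
  proof -
    have "x \<in> \<Union>(\<U> n)" if xC: "x \<in> C" for x
    proof -
      obtain G where G: "G \<in> A n" "openin X G" "x \<in> G"
        using A[of n] xC CX unfolding open_covers_def by blast
      obtain P Q where PQ: "openin X P" "closedin X Q" "x \<in> P" "P \<subseteq> Q" "Q \<subseteq> G"
        using X[folded neighbourhood_base_of_closedin, unfolded neighbourhood_base_of,
            THEN spec, THEN spec, THEN mp, OF conjI[OF G(2,3)]]
        by (elim exE conjE)
      then have "X closure_of P \<subseteq> G"
        using closure_of_minimal[OF PQ(4,2)] by blast
      then show ?thesis
        using PQ(1,3) G(1) xC unfolding \<U>_def by blast
    qed
    then have "\<Union>(\<U> n) = C" unfolding \<U>_def by blast
    moreover have "\<forall>U\<in>\<U> n. openin (subtopology X C) U"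
      unfolding \<U>_def by (auto simp: openin_subtopology)
    ultimately show ?thesis
      using CX by (auto simp: open_covers_def)
  qed
  with Hur[unfolded Hurewicz_space_def topspace_subtopology_subset[OF CX], rule_format, of \<U>]
  obtain \<V> where V: "\<And>n. finite (\<V> n)" "\<And>n. \<V> n \<subseteq> \<U> n"
    "\<And>y. y \<in> C \<Longrightarrow> finite {n. y \<notin> \<Union>(\<V> n)}"
    by blast
  define R where
    "R n V p \<longleftrightarrow> V \<subseteq> fst p \<and> openin X (fst p) \<and> snd p \<in> A n \<and> X closure_of (fst p) \<subseteq> snd p"
    for n V p
  define P where "P n V = fst (SOME p. R n V p)" for n V
  define G where "G n V = snd (SOME p. R n V p)" for n V
  have PG: "V \<subseteq> P n V \<and> openin X (P n V) \<and> G n V \<in> A n \<and> X closure_of (P n V) \<subseteq> G n V"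
    if "V \<in> \<V> n" for n V
  proof -
    have "V \<in> \<U> n" using V(2) that by blast
    then obtain Q H where "V = C \<inter> Q" "openin X Q" "H \<in> A n" "X closure_of Q \<subseteq> H"
      unfolding \<U>_def by blast
    then have "R n V (Q, H)" by (simp add: R_def)
    then have "R n V (SOME p. R n V p)" by (rule someI)
    then show ?thesis unfolding P_def G_def R_def .
  qed
  define F where "F n = (\<Union>V\<in>\<V> n. X closure_of (P n V))" for n
  have VF: "\<Union>(\<V> n) \<subseteq> F n" for n
  proof -
    have "V \<subseteq> X closure_of (P n V)" if "V \<in> \<V> n" for V
      using PG[OF that] closure_of_subset[OF openin_subset] by blast
    then show ?thesis unfolding F_def by blast
  qed
  show ?thesis
  proof
    show "closedin X (F n)" for n
      unfolding F_def using V(1) by (intro closedin_Union) auto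
    show "finite (G n ` \<V> n)" for n using V(1) by simp
    show "G n ` \<V> n \<subseteq> A n" for n using PG by blast
    show "F n \<subseteq> \<Union>(G n ` \<V> n)" for n using PG unfolding F_def by blast
    show "finite {n. x \<notin> F n}" if "x \<in> C" for x
      using V(3)[OF that] by (rule finite_subset[rotated]) (use VF in blast)
  qed
qed

text \<open>Since \<open>D m\<close> is closed and lies in \<open>F n\<close> for all \<open>n \<ge> m\<close>, adding its complement turns the finite
  part \<open>\<G> n\<close> of \<open>A n\<close> into a finite open cover of \<open>X\<close>. A member of a refinement of it that meets \<open>D m\<close>
  lies in a member of \<open>A n\<close>; the others may be discarded without uncovering any point of
  \<open>D m\<close>.\<close>

lemma Hurewicz_space_imp_selectively_screenable_in:
  assumes X: "regular_space X" and CX: "C \<subseteq> topspace X"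
    and Hur: "Hurewicz_space (subtopology X C)"
    and Sc: "S_c (finite_open_covers X) (open_covers X)"
  shows "selectively_screenable_in X C"
  unfolding selectively_screenable_in_def
proof (intro allI impI)
  fix A :: "nat \<Rightarrow> 'a set set"
  assume A: "\<forall>n. A n \<in> open_covers X"
  obtain F \<G> where F: "\<And>n. closedin X (F n)" and G: "\<And>n. finite (\<G> n)" "\<And>n. \<G> n \<subseteq> A n"
    and FG: "\<And>n. F n \<subseteq> \<Union>(\<G> n)" and CF: "\<And>x. x \<in> C \<Longrightarrow> finite {n. x \<notin> F n}"
    using Hurewicz_space_closed_selection[OF X CX Hur, of A] A by metis
  define D where "D m = (\<Inter>n\<in>{m..}. F n)" for m
  have D: "closedin X (D m)" for m
    unfolding D_def using F by (intro closedin_Inter) auto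
  \<comment> \<open>The pairing function gives each \<open>m\<close> an infinite set of indices of its own, and it satisfies
    \<open>m \<le> prod_encode (m, j)\<close>, as needed for \<open>D m\<close> to be covered.\<close>
  define P where "P m j = insert (topspace X - D m) (\<G> (prod_encode (m, j)))" for m j
  have "P m j \<in> finite_open_covers X" for m j
  proof -
    have "D m \<subseteq> \<Union>(\<G> (prod_encode (m, j)))"
      using FG le_prod_encode_1[of m j] unfolding D_def by blast
    moreover have GX: "openin X U" if "U \<in> \<G> n" for n U
      using that G(2) A unfolding open_covers_def by blast
    moreover have "\<Union>(\<G> n) \<subseteq> topspace X" for n
      using GX openin_subset by blast
    ultimately show ?thesis
      using G(1) openin_diff[OF openin_topspace D[of m]]
      unfolding P_def finite_open_covers_def open_covers_def by fastforce
  qed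
  then have "\<exists>B. (\<forall>j. pairwise disjnt (B j) \<and> refines (B j) (P m j)) \<and>
      (\<Union>j. B j) \<in> open_covers X" for m
    using Sc unfolding S_c_def by blast
  then obtain B where B: "\<And>m j. pairwise disjnt (B m j)" "\<And>m j. refines (B m j) (P m j)"
    "\<And>m. (\<Union>j. B m j) \<in> open_covers X"
    by metis
  define B' where
    "B' n = {V \<in> B (fst (prod_decode n)) (snd (prod_decode n)). \<exists>U\<in>A n. V \<subseteq> U}" for n
  have "disjoint_open_refinement X (B' n) (A n)" for n
    unfolding disjoint_open_refinement_def
  proof (intro conjI)
    show "pairwise disjnt (B' n)"
      by (rule pairwise_subset[OF B(1)]) (auto simp: B'_def)
    show "refines (B' n) (A n)" by (simp add: B'_def refines_def)
    show "\<forall>V\<in>B' n. openin X V"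
      using B(3)[of "fst (prod_decode n)"] by (auto simp: B'_def open_covers_def)
  qed
  moreover have "C \<subseteq> (\<Union>n. \<Union>(B' n))"
  proof
    fix x assume "x \<in> C"
    obtain m where m: "\<And>n. x \<notin> F n \<Longrightarrow> n < m"
      using CF[OF \<open>x \<in> C\<close>] unfolding finite_nat_set_iff_bounded by blast
    then have "x \<in> D m" unfolding D_def by (meson INT_I atLeast_iff not_le)
    have "x \<in> \<Union>(\<Union>j. B m j)"
      using B(3)[of m] \<open>x \<in> C\<close> CX unfolding open_covers_def by auto
    then obtain j V where V: "V \<in> B m j" "x \<in> V" by blast
    obtain U where U: "U \<in> P m j" "V \<subseteq> U" using B(2) V(1) unfolding refines_def by blast
    have "U \<in> \<G> (prod_encode (m, j))" using U V(2) \<open>x \<in> D m\<close> by (auto simp: P_def)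
    then have "V \<in> B' (prod_encode (m, j))"
      using V(1) U(2) G(2) unfolding B'_def by auto
    then show "x \<in> (\<Union>n. \<Union>(B' n))" using V(2) by blast
  qed
  ultimately show "\<exists>B. (\<forall>n. disjoint_open_refinement X (B n) (A n)) \<and> C \<subseteq> (\<Union>n. \<Union>(B n))"
    by blast
qed

text \<open>The even-numbered covers serve for \<open>C\<close>. What they leave uncovered is the complement of an open
  set containing \<open>C\<close>, and the odd-numbered covers serve for that.\<close>

lemma S_c_from_selectively_screenable_in:
  assumes C: "selectively_screenable_in X C"
    and co: "\<And>U. openin X U \<Longrightarrow> C \<subseteq> U \<Longrightarrow> selectively_screenable_in X (topspace X - U)"
  shows "S_c (open_covers X) (open_covers X)"
  unfolding S_c_def
proof (intro allI impI)
  fix A :: "nat \<Rightarrow> 'a set set"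
  assume A: "\<forall>n. A n \<in> open_covers X"
  obtain B where B: "\<And>n. disjoint_open_refinement X (B n) (A (2 * n))"
    and CB: "C \<subseteq> (\<Union>n. \<Union>(B n))"
    using C[unfolded selectively_screenable_in_def, THEN spec, of "\<lambda>n. A (2 * n)", THEN mp] A
    by auto
  define U where "U = (\<Union>n. \<Union>(B n))"
  have "openin X U" unfolding U_def using B
    by (intro openin_Union) (auto simp: disjoint_open_refinement_def)
  then have co_U: "selectively_screenable_in X (topspace X - U)"
    using co CB unfolding U_def by blast
  obtain B' where
    B': "\<And>n. disjoint_open_refinement X (B' n) (A (2 * n + 1))"
    and CB': "topspace X - U \<subseteq> (\<Union>n. \<Union>(B' n))"
    using co_U[unfolded selectively_screenable_in_def, THEN spec, of "\<lambda>n. A (2 * n + 1)", THEN mp] A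
    by auto
  define E where "E n = (if even n then B (n div 2) else B' (n div 2))" for n
  have "disjoint_open_refinement X (E n) (A n)" for n
  proof (cases "even n")
    case True
    then show ?thesis using B[of "n div 2"] by (simp add: E_def)
  next
    case False
    then show ?thesis using B'[of "n div 2"] by (simp add: E_def)
  qed
  then have E: "pairwise disjnt (E n) \<and> refines (E n) (A n) \<and> (\<forall>V\<in>E n. openin X V)" for n
    by (simp add: disjoint_open_refinement_def)
  have BE: "B n \<subseteq> E (2 * n)" "B' n \<subseteq> E (2 * n + 1)" for n
    by (auto simp: E_def)
  have "topspace X \<subseteq> \<Union>(\<Union>n. E n)"
  proof
    fix x assume "x \<in> topspace X"
    then have "x \<in> U \<or> x \<in> (\<Union>n. \<Union>(B' n))" using CB' by blast
    then obtain n where "x \<in> \<Union>(B n) \<or> x \<in> \<Union>(B' n)" unfolding U_def by blast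
    then show "x \<in> \<Union>(\<Union>n. E n)" using BE[of n] by blast
  qed
  moreover have "\<Union>(\<Union>n. E n) \<subseteq> topspace X"
    using E openin_subset by blast
  ultimately have "(\<Union>n. E n) \<in> open_covers X"
    using E by (auto simp: open_covers_def)
  then show "\<exists>B. (\<forall>n. pairwise disjnt (B n) \<and> refines (B n) (A n)) \<and> (\<Union>n. B n) \<in> open_covers X"
    using E by blast
qed

theorem corollary6:
  fixes X :: "'a metric" and C :: "'a set"
  assumes "infinite (mspace X)"
    and "separable_space (mtopology_of X)"
    and "fsigma_in (mtopology_of X) C"
    and "Hurewicz_space (subtopology (mtopology_of X) C)"
    and "\<And>U. openin (mtopology_of X) U \<Longrightarrow> C \<subseteq> U \<Longrightarrow>
           finite_dimensional (subtopology (mtopology_of X) (mspace X - U))"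
  shows "S_c (open_covers (mtopology_of X)) (open_covers (mtopology_of X)) \<longleftrightarrow>
         S_c (finite_open_covers (mtopology_of X)) (open_covers (mtopology_of X))"
proof
  let ?T = "mtopology_of X"
  show "S_c (finite_open_covers ?T) (open_covers ?T)" if "S_c (open_covers ?T) (open_covers ?T)"
    using that unfolding S_c_def finite_open_covers_def by blast
  assume Sc: "S_c (finite_open_covers ?T) (open_covers ?T)"
  have met: "metrizable_space ?T"
    unfolding mtopology_of_def
    by (rule Metric_space.metrizable_space_mtopology[OF Metric_space_mspace_mdist])
  show "S_c (open_covers ?T) (open_covers ?T)"
  proof (rule S_c_from_selectively_screenable_in)
    show "selectively_screenable_in ?T C"
      using metrizable_imp_regular_space[OF met] fsigma_in_subset[OF assms(3)] assms(4) Sc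
      by (rule Hurewicz_space_imp_selectively_screenable_in)
    show "selectively_screenable_in ?T (topspace ?T - U)" if "openin ?T U" "C \<subseteq> U" for U
      using met separable_metrizable_imp_second_countable[OF met assms(2)] _ assms(5)[OF that]
      unfolding topspace_mtopology_of
      by (rule finite_dimensional_imp_selectively_screenable_in) simp
  qed
qed

end
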